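(* Let $m\ge 3$ and $k\ge 1$ be integers, let $P_{m,k}$ be the generalized Petersen graph of order $2m$, and let $T$ be a tree of order $n$. Put $d_p=\mathrm{diam}(P_{m,k})$, $d_t=\mathrm{diam}(T)$ and $\varepsilon=\varepsilon(T)$. Then $$\mathrm{rn}(P_{m,k}\Box T)=(2mn-1)(d_t+\varepsilon)-4m\,L(T)$$ if and only if there exists an ordering $z_0,z_1,\ldots,z_{2mn-1}$ of $V(P_{m,k}\Box T)$, where $z_t=(x_{i_t},y_{j_t})$ with $x_{i_t}\in V(P_{m,k})$ and $y_{j_t}\in V(T)$, such that all of the following hold: (a) $d_{P_{m,k}}(x_{i_t},x_{i_{t+1}})=d_p$ for all $0\le t\le 2mn-2$; (b) $L_T(y_{j_0})+L_T(y_{j_{2mn-1}})=0$; (c) for any $z_a=(x_{i_a},y_{j_a})$ and $z_b=(x_{i_b},y_{j_b})$ with $0\le a<b\le 2mn-1$, $$d_T(y_{j_a},y_{j_b})+d_{P_{m,k}}(x_{i_a},x_{i_b})\;\ge\;\sum_{t=a}^{b-1}\bigl(L_T(y_{j_t})+L_T(y_{j_{t+1}})-d_t-\varepsilon\bigr)+d_t+d_p+1,$$ where $d_t$ always denotes $\mathrm{diam}(T)$ (it does not depend on the summation index $t$).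
   Context: Radio labeling: for a connected graph $G$, a radio labeling is a map $f:V(G)\to\{0,1,2,\ldots\}$ with $|f(u)-f(v)|\ge \mathrm{diam}(G)+1-d_G(u,v)$ for all distinct $u,v\in V(G)$. Its span is $\max\{|f(u)-f(v)|:u,v\in V(G)\}$, and the radio number $\mathrm{rn}(G)$ is the minimum span over all radio labelings of $G$. Generalized Petersen graph: for $m\ge 3$, $k\ge 1$, $P_{m,k}$ has vertex set $\{u_i,v_i:i\in\mathbb{Z}_m\}$ and edge set $\{u_iu_{i+1},\,u_iv_i,\,v_iv_{i+k}:i\in\mathbb{Z}_m\}$ (indices mod $m$). Cartesian product: $G\Box H$ has vertex set $V(G)\times V(H)$, with $(g,h)$ and $(g',h')$ adjacent iff ($g g'\in E(G)$ and $h=h'$) or ($g=g'$ and $hh'\in E(H)$). Weight centers: for a tree $T$, $w_T(u)=\sum_{v\in V(T)}d_T(u,v)$; a weight center is a vertex minimizing $w_T$, and $W(T)$ is the set of weight centers. It is known that $|W(T)|\in\{1,2\}$, and if $W(T)=\{w,w'\}$ then $ww'$ is an edge of $T$. Set $\varepsilon(T)=1$ if $|W(T)|=1$ and $\varepsilon(T)=0$ if $|W(T)|=2$. Levels: $L_T(x)=\min\{d_T(x,w):w\in W(T)\}$ and $L(T)=\sum_{x\in V(T)}L_T(x)$. *)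

theory Defs
  imports "Graph_Theory.Digraph_Component"
begin

text \<open>
  An undirected graph is a finite symmetric digraph: an edge \<open>uv\<close> is the pair of arcs
  \<open>(u, v)\<close>, \<open>(v, u)\<close>. The notions below are meant for connected graphs; in particular
  \<open>gdist\<close> is the junk value \<open>Inf {} = 0\<close> for vertices not joined by a walk.
\<close>

definition gdist :: "'a pair_pre_digraph \<Rightarrow> 'a \<Rightarrow> 'a \<Rightarrow> nat" where
  "gdist G u v = Inf {length p | p. pre_digraph.awalk (with_proj G) u p v}"

definition diam :: "'a pair_pre_digraph \<Rightarrow> nat" where
  "diam G = Max {gdist G u v | u v. u \<in> pverts G \<and> v \<in> pverts G}"

text \<open>
  The library's \<^const>\<open>tree\<close> does not serve here: in a symmetric digraph it counts the
  closed walk \<open>u, v, u\<close> along a single edge as a cycle. Undirected cycles are exactly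
  the library's cycles with at least three arcs. Connectedness includes being nonempty.
\<close>

definition undirected_tree :: "'a pair_pre_digraph \<Rightarrow> bool" where
  "undirected_tree T \<longleftrightarrow> pair_graph T \<and> connected (with_proj T) \<and>
     \<not> (\<exists>p. pre_digraph.cycle (with_proj T) p \<and> 3 \<le> length p)"

definition cartesian_product ::
  "'a pair_pre_digraph \<Rightarrow> 'b pair_pre_digraph \<Rightarrow> ('a \<times> 'b) pair_pre_digraph" (infixr \<open>\<box>\<close> 70) where
  "G \<box> H =
     \<lparr> pverts = pverts G \<times> pverts H,
       parcs = {((g, h), (g', h')) | g h g' h'.
         g \<in> pverts G \<and> g' \<in> pverts G \<and> h \<in> pverts H \<and> h' \<in> pverts H \<and>
         ((g, g') \<in> parcs G \<and> h = h' \<or> g = g' \<and> (h, h') \<in> parcs H)} \<rparr>"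

datatype petersen_vertex = U nat | V nat

text \<open>
  Indices in \<open>\<int>\<^sub>m\<close> are represented by residues below \<open>m\<close>. If \<open>m\<close> divides \<open>k\<close>, the pairs
  \<open>v\<^sub>i v\<^sub>i\<^sub>+\<^sub>k\<close> are loops; they change no distance.
\<close>

definition petersen :: "nat \<Rightarrow> nat \<Rightarrow> petersen_vertex pair_pre_digraph" where
  "petersen m k =
     (let E = {(U i, U ((i + 1) mod m)) | i. i < m} \<union>
              {(U i, V i) | i. i < m} \<union>
              {(V i, V ((i + k) mod m)) | i. i < m}
      in \<lparr> pverts = U ` {..<m} \<union> V ` {..<m}, parcs = E \<union> E\<inverse> \<rparr>)"

definition radio_labeling :: "'a pair_pre_digraph \<Rightarrow> ('a \<Rightarrow> nat) \<Rightarrow> bool" where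
  "radio_labeling G f \<longleftrightarrow>
     (\<forall>u \<in> pverts G. \<forall>v \<in> pverts G. u \<noteq> v \<longrightarrow>
        \<bar>int (f u) - int (f v)\<bar> \<ge> int (diam G) + 1 - int (gdist G u v))"

definition label_span :: "'a pair_pre_digraph \<Rightarrow> ('a \<Rightarrow> nat) \<Rightarrow> nat" where
  "label_span G f =
     Max {nat \<bar>int (f u) - int (f v)\<bar> | u v. u \<in> pverts G \<and> v \<in> pverts G}"

definition radio_number :: "'a pair_pre_digraph \<Rightarrow> nat" where
  "radio_number G = Inf {label_span G f | f. radio_labeling G f}"

definition weight :: "'a pair_pre_digraph \<Rightarrow> 'a \<Rightarrow> nat" where
  "weight T u = (\<Sum>v \<in> pverts T. gdist T u v)"

definition weight_centers :: "'a pair_pre_digraph \<Rightarrow> 'a set" where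
  "weight_centers T = {u \<in> pverts T. \<forall>v \<in> pverts T. weight T u \<le> weight T v}"

definition center_eps :: "'a pair_pre_digraph \<Rightarrow> nat" where
  "center_eps T = (if card (weight_centers T) = 1 then 1 else 0)"

definition level :: "'a pair_pre_digraph \<Rightarrow> 'a \<Rightarrow> nat" where
  "level T x = Min {gdist T x w | w. w \<in> weight_centers T}"

definition total_level :: "'a pair_pre_digraph \<Rightarrow> nat" where
  "total_level T = (\<Sum>x \<in> pverts T. level T x)"

end

theory Submission
  imports Defs "HOL-Library.Infinite_Set"
begin

text \<open>
  The Petersen graph enters as a connected graph of order \<open>2m\<close>, and the argument is carried out
  for \<open>G \<box> T\<close> with \<open>G\<close> any connected graph and \<open>T\<close> a tree.

  Radio labels of distinct vertices differ, so a radio labeling lists the vertices as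
  \<open>z\<^sub>0, \<dots>, z\<^sub>l\<close> in order of increasing label, and its span is the sum of the consecutive
  differences of labels. Distances and diameters add up in the product
  (\<open>gdist_product\<close>, \<open>diam_product\<close>), so for \<open>z\<^sub>t = (x\<^sub>t, y\<^sub>t)\<close> the radio condition reads
  \<open>f z\<^sub>t\<^sub>+\<^sub>1 - f z\<^sub>t \<ge> (diam G - d(x\<^sub>t, x\<^sub>t\<^sub>+\<^sub>1)) + (diam T + 1 - d(y\<^sub>t, y\<^sub>t\<^sub>+\<^sub>1))\<close>.
  The first summand is nonnegative. For the second one, the tree inequality
  \<open>d(y, y') \<le> L(y) + L(y') + 1 - \<epsilon>\<close> (\<open>gdist_le_levels\<close>) leaves at least
  \<open>diam T + \<epsilon> - L(y\<^sub>t) - L(y\<^sub>t\<^sub>+\<^sub>1)\<close>, the tight gap. The tight gaps telescope: each level is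
  subtracted twice, except those of the two ends. Every span is therefore the asserted value, plus
  the levels of the two ends, plus the excesses of the differences over the tight gaps, and all of
  these are nonnegative (\<open>span_eq_bound_plus_excess\<close>, \<open>excess_ge\<close>).

  If the radio number equals the bound, all these terms vanish for an optimal labeling. The ends are
  then weight centers, consecutive \<open>x\<^sub>t\<close> are at distance \<open>diam G\<close>, and differences of
  labels are sums of tight gaps, which turns the radio condition for arbitrary pairs into condition
  (c). Conversely, an ordering with (b) and (c) is labeled by the partial sums of its tight gaps.
  Condition (c) for consecutive vertices makes the gaps positive, (c) as a whole is the radio
  condition, and the span is the bound.

  The inequality \<open>gdist_le_levels\<close> rests on the fact that two weight centers of a tree are at
  distance at most one, which follows from the strict convexity of the weight along paths
  (\<open>weight_strictly_convex\<close>).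
\<close>

section \<open>Distances in connected graphs\<close>

text \<open>
  Loops are admitted, because \<^term>\<open>petersen m k\<close> has them when \<open>m\<close> divides \<open>k\<close>.
\<close>

locale connected_graph = pair_pseudo_graph +
  assumes verts_nonempty: "pverts G \<noteq> {}"
    and walk_exists: "u \<in> pverts G \<Longrightarrow> v \<in> pverts G \<Longrightarrow> \<exists>p. awalk u p v"
begin

lemma gdist_le_length: "awalk u p v \<Longrightarrow> gdist G u v \<le> length p"
  unfolding gdist_def by (rule wellorder_Inf_le1) auto

lemma geodesic:
  assumes "u \<in> pverts G" "v \<in> pverts G"
  obtains p where "awalk u p v" "length p = gdist G u v"
proof -
  have "{length p | p. awalk u p v} \<noteq> {}"
    using walk_exists[OF assms] by auto
  then have "gdist G u v \<in> {length p | p. awalk u p v}"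
    unfolding gdist_def by (metis (no_types, lifting) all_not_in_conv wellorder_InfI)
  then show thesis
    using that by auto
qed

lemma gdist_self [simp]: "u \<in> pverts G \<Longrightarrow> gdist G u u = 0"
  using gdist_le_length[of u "[]" u] by (simp add: awalk_Nil_iff)

lemma gdist_eq_0_iff:
  assumes "u \<in> pverts G" "v \<in> pverts G"
  shows "gdist G u v = 0 \<longleftrightarrow> u = v"
  using geodesic[OF assms] assms by (metis awalk_Nil_iff gdist_self length_0_conv)

lemma gdist_commute_le:
  assumes "u \<in> pverts G" "v \<in> pverts G"
  shows "gdist G v u \<le> gdist G u v"
proof -
  obtain p where "awalk u p v" "length p = gdist G u v"
    using geodesic[OF assms] .
  moreover have "length (rev_path q) = length q" for q :: "('a \<times> 'a) list"
    by (induction q) auto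
  ultimately show ?thesis
    by (metis awalk_rev_path gdist_le_length)
qed

lemma gdist_commute:
  assumes "u \<in> pverts G" "v \<in> pverts G"
  shows "gdist G v u = gdist G u v"
  using gdist_commute_le assms by (simp add: order_antisym)

lemma gdist_triangle:
  assumes "u \<in> pverts G" "v \<in> pverts G" "w \<in> pverts G"
  shows "gdist G u w \<le> gdist G u v + gdist G v w"
proof -
  obtain p where "awalk u p v" "length p = gdist G u v"
    using geodesic assms by metis
  moreover obtain q where "awalk v q w" "length q = gdist G v w"
    using geodesic assms by metis
  ultimately show ?thesis
    by (metis awalk_appendI gdist_le_length length_append)
qed

lemma gdist_arc_le_1: "(u, v) \<in> parcs G \<Longrightarrow> gdist G u v \<le> 1"
  using gdist_le_length[of u "[(u, v)]" v] by (simp add: awalk_simps wellformed')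

lemma gdist_arc_le:
  assumes "(u, u') \<in> parcs G" "v \<in> pverts G"
  shows "gdist G u v \<le> Suc (gdist G u' v)"
  using gdist_triangle[of u u' v] gdist_arc_le_1[OF assms(1)] assms wellformed' by fastforce

lemma gdist_step:
  assumes "u \<in> pverts G" "v \<in> pverts G" "u \<noteq> v"
  obtains u' where "(u, u') \<in> parcs G" "gdist G u v = Suc (gdist G u' v)"
proof -
  obtain p where p: "awalk u p v" "length p = gdist G u v"
    using geodesic assms by metis
  with assms(3) obtain u' q where "p = (u, u') # q"
    by (cases p) (auto simp: awalk_simps)
  with p have "(u, u') \<in> parcs G" "awalk u' q v" "gdist G u v = Suc (length q)"
    by (auto simp: awalk_simps)
  with gdist_le_length[of u' q v] gdist_arc_le[of u u' v] assms show thesis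
    by (intro that[of u']) auto
qed

lemma finite_gdists: "finite {gdist G u v | u v. u \<in> pverts G \<and> v \<in> pverts G}"
proof -
  have "{gdist G u v | u v. u \<in> pverts G \<and> v \<in> pverts G}
      = (\<lambda>(u, v). gdist G u v) ` (pverts G \<times> pverts G)"
    by auto
  then show ?thesis
    using pair_finite_verts by simp
qed

lemma gdist_le_diam: "u \<in> pverts G \<Longrightarrow> v \<in> pverts G \<Longrightarrow> gdist G u v \<le> diam G"
  unfolding diam_def using finite_gdists by (intro Max_ge) auto

lemma diam_attained:
  obtains u v where "u \<in> pverts G" "v \<in> pverts G" "gdist G u v = diam G"
proof -
  have "diam G \<in> {gdist G u v | u v. u \<in> pverts G \<and> v \<in> pverts G}"
    unfolding diam_def using finite_gdists verts_nonempty by (intro Max_in) auto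
  then show thesis
    using that by auto
qed

end

section \<open>Distances in Cartesian products\<close>

locale graph_product = G: connected_graph G + H: connected_graph H
  for G :: "'a pair_pre_digraph" and H :: "'b pair_pre_digraph"
begin

lemma pverts_product [simp]: "pverts (G \<box> H) = pverts G \<times> pverts H"
  by (simp add: cartesian_product_def)

lemma parcs_product:
  "((g, h), (g', h')) \<in> parcs (G \<box> H) \<longleftrightarrow>
     (g, g') \<in> parcs G \<and> h = h' \<and> h \<in> pverts H \<or> g = g' \<and> g \<in> pverts G \<and> (h, h') \<in> parcs H"
  by (auto simp: cartesian_product_def G.wellformed' H.wellformed')

sublocale P: pair_pseudo_graph "G \<box> H"
proof
  have sub: "parcs (G \<box> H) \<subseteq> pverts (G \<box> H) \<times> pverts (G \<box> H)"
    by (auto simp: cartesian_product_def)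
  then show "fst e \<in> pverts (G \<box> H)" "snd e \<in> pverts (G \<box> H)" if "e \<in> parcs (G \<box> H)" for e
    using that by auto
  show fin: "finite (pverts (G \<box> H))"
    using G.pair_finite_verts H.pair_finite_verts by simp
  show "finite (parcs (G \<box> H))"
    using sub fin by (meson finite_SigmaI finite_subset)
  show "symmetric (with_proj (G \<box> H))"
    unfolding symmetric_def with_proj_simps
    by (rule symI) (auto simp: parcs_product G.arcs_symmetric H.arcs_symmetric)
qed

lemma awalk_lift_fst:
  assumes "G.awalk g p g'" "h \<in> pverts H"
  shows "\<exists>q. P.awalk (g, h) q (g', h) \<and> length q = length p"
  using assms(1)
proof (induction p arbitrary: g)
  case Nil
  then show ?case
    using assms(2) by (intro exI[of _ "[]"]) (auto simp: G.awalk_Nil_iff P.awalk_Nil_iff)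
next
  case (Cons e p)
  then obtain g'' where e: "e = (g, g'')" "(g, g'') \<in> parcs G" "G.awalk g'' p g'"
    by (cases e) (auto simp: G.awalk_simps)
  with Cons.IH obtain q where q: "P.awalk (g'', h) q (g', h)" "length q = length p"
    by blast
  show ?case
    using e q assms(2) G.wellformed'
    by (intro exI[of _ "((g, h), (g'', h)) # q"]) (auto simp: P.awalk_simps parcs_product)
qed

lemma awalk_lift_snd:
  assumes "H.awalk h p h'" "g \<in> pverts G"
  shows "\<exists>q. P.awalk (g, h) q (g, h') \<and> length q = length p"
  using assms(1)
proof (induction p arbitrary: h)
  case Nil
  then show ?case
    using assms(2) by (intro exI[of _ "[]"]) (auto simp: H.awalk_Nil_iff P.awalk_Nil_iff)
next
  case (Cons e p)
  then obtain h'' where e: "e = (h, h'')" "(h, h'') \<in> parcs H" "H.awalk h'' p h'"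
    by (cases e) (auto simp: H.awalk_simps)
  with Cons.IH obtain q where q: "P.awalk (g, h'') q (g, h')" "length q = length p"
    by blast
  show ?case
    using e q assms(2) H.wellformed'
    by (intro exI[of _ "((g, h), (g, h'')) # q"]) (auto simp: P.awalk_simps parcs_product)
qed

lemma product_walk:
  assumes "g \<in> pverts G" "g' \<in> pverts G" "h \<in> pverts H" "h' \<in> pverts H"
  obtains p where "P.awalk (g, h) p (g', h')" "length p = gdist G g g' + gdist H h h'"
proof -
  obtain q where "G.awalk g q g'" "length q = gdist G g g'"
    using G.geodesic assms by metis
  with awalk_lift_fst assms obtain q'
    where q': "P.awalk (g, h) q' (g', h)" "length q' = gdist G g g'" by metis
  obtain r where "H.awalk h r h'" "length r = gdist H h h'"
    using H.geodesic assms by metis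
  with awalk_lift_snd assms obtain r'
    where r': "P.awalk (g', h) r' (g', h')" "length r' = gdist H h h'" by metis
  show thesis
    using q' r' by (intro that[of "q' @ r'"]) auto
qed

sublocale P: connected_graph "G \<box> H"
proof
  show "pverts (G \<box> H) \<noteq> {}"
    using G.verts_nonempty H.verts_nonempty by simp
  show "\<exists>p. P.awalk u p v" if uv: "u \<in> pverts (G \<box> H)" "v \<in> pverts (G \<box> H)" for u v
    using uv by (cases u; cases v) (auto elim: product_walk)
qed

text \<open>
  The sum of the two distances to a fixed vertex drops by at most one along each arc of the
  product, so no walk to that vertex can be shorter than this sum.
\<close>

lemma product_walk_length_ge:
  assumes "P.awalk u p (g', h')"
  shows "gdist G (fst u) g' + gdist H (snd u) h' \<le> length p"
  using assms
proof (induction p arbitrary: u)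
  case Nil
  then show ?case
    by (auto simp: P.awalk_Nil_iff)
next
  case (Cons e p)
  obtain g h g'' h'' where e: "e = ((g, h), (g'', h''))"
    by (cases e) auto
  have walk: "P.awalk (g'', h'') p (g', h')" and u: "u = (g, h)"
    and arc: "((g, h), (g'', h'')) \<in> parcs (G \<box> H)"
    using Cons.prems e by (auto simp: P.awalk_simps)
  have "g' \<in> pverts G" "h' \<in> pverts H"
    using P.awalk_last_in_verts[OF walk] by auto
  with arc have "gdist G g g' + gdist H h h' \<le> Suc (gdist G g'' g' + gdist H h'' h')"
    using G.gdist_arc_le H.gdist_arc_le by (fastforce simp: parcs_product)
  then show ?case
    using Cons.IH[OF walk] u by simp
qed

lemma gdist_product:
  assumes "g \<in> pverts G" "g' \<in> pverts G" "h \<in> pverts H" "h' \<in> pverts H"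
  shows "gdist (G \<box> H) (g, h) (g', h') = gdist G g g' + gdist H h h'"
proof (rule antisym)
  show "gdist (G \<box> H) (g, h) (g', h') \<le> gdist G g g' + gdist H h h'"
    using product_walk[OF assms] P.gdist_le_length by metis
  obtain p where "P.awalk (g, h) p (g', h')" "length p = gdist (G \<box> H) (g, h) (g', h')"
    using P.geodesic assms by (metis SigmaI pverts_product)
  then show "gdist G g g' + gdist H h h' \<le> gdist (G \<box> H) (g, h) (g', h')"
    using product_walk_length_ge[of "(g, h)" p g' h'] by simp
qed

lemma diam_product: "diam (G \<box> H) = diam G + diam H"
proof (rule antisym)
  obtain u v
    where "u \<in> pverts (G \<box> H)" "v \<in> pverts (G \<box> H)" "gdist (G \<box> H) u v = diam (G \<box> H)"
    using P.diam_attained .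
  then show "diam (G \<box> H) \<le> diam G + diam H"
    using gdist_product[of "fst u" "fst v" "snd u" "snd v"]
      G.gdist_le_diam[of "fst u" "fst v"] H.gdist_le_diam[of "snd u" "snd v"]
    by (auto simp: mem_Times_iff)
  obtain g g' where g: "g \<in> pverts G" "g' \<in> pverts G" "gdist G g g' = diam G"
    using G.diam_attained .
  obtain h h' where h: "h \<in> pverts H" "h' \<in> pverts H" "gdist H h h' = diam H"
    using H.diam_attained .
  show "diam G + diam H \<le> diam (G \<box> H)"
    using P.gdist_le_diam[of "(g, h)" "(g', h')"] g h by (simp add: gdist_product)
qed

end

section \<open>Radio labelings as increasing enumerations\<close>

lemma finite_injective_ordering:
  fixes f :: "'a \<Rightarrow> nat"
  assumes "finite S" "inj_on f S" and card: "card S = Suc l"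
  obtains z where "bij_betw z {0..l} S" "strict_mono_on {0..l} (\<lambda>t. f (z t))"
proof -
  obtain h where h: "bij_betw h {..<card (f ` S)} (f ` S)" "strict_mono_on {..<card (f ` S)} h"
    using ex_bij_betw_strict_mono_card[OF finite_imageI[OF assms(1)]] by blast
  have dom: "{..<card (f ` S)} = {0..l}"
    using card assms by (auto simp: card_image)
  define z where "z = the_inv_into S f \<circ> h"
  have "bij_betw (the_inv_into S f) (f ` S) S"
    using assms by (simp add: bij_betw_the_inv_into inj_on_imp_bij_betw)
  then have "bij_betw z {0..l} S"
    unfolding z_def using h(1) dom bij_betw_trans by metis
  moreover have "strict_mono_on {0..l} (\<lambda>t. f (z t))"
  proof (rule strict_mono_onI)
    fix a b assume ab: "a \<in> {0..l}" "b \<in> {0..l}" "a < b"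
    have fz: "f (z t) = h t" if "t \<le> l" for t
    proof -
      have "h t \<in> f ` S"
        using bij_betwE[OF h(1)] dom that by auto
      then show ?thesis
        using assms(2) by (simp add: z_def f_the_inv_into_f)
    qed
    have "h a < h b"
      using h(2) dom ab by (auto intro: strict_mono_onD)
    then show "f (z a) < f (z b)"
      using fz ab by simp
  qed
  ultimately show thesis
    using that by blast
qed

lemma finite_label_differences:
  fixes f :: "'a \<Rightarrow> nat"
  assumes "finite S"
  shows "finite {nat \<bar>int (f u) - int (f v)\<bar> | u v. u \<in> S \<and> v \<in> S}"
proof -
  have "{nat \<bar>int (f u) - int (f v)\<bar> | u v. u \<in> S \<and> v \<in> S}
      = (\<lambda>(u, v). nat \<bar>int (f u) - int (f v)\<bar>) ` (S \<times> S)"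
    by auto
  then show ?thesis
    using assms by simp
qed

lemma label_span_ordered:
  fixes z :: "nat \<Rightarrow> 'a" and f :: "'a \<Rightarrow> nat"
  assumes z: "bij_betw z {0..l} (pverts G)"
    and mono: "strict_mono_on {0..l} (\<lambda>t. f (z t))"
  shows "int (label_span G f) = int (f (z l)) - int (f (z 0))"
proof -
  have le: "f (z a) \<le> f (z b)" if "a \<le> b" "b \<le> l" for a b
    using strict_mono_on_leD[OF mono, of a b] that by simp
  have range: "f (z 0) \<le> f u \<and> f u \<le> f (z l)" if u: "u \<in> pverts G" for u
  proof -
    have "u \<in> z ` {0..l}"
      using bij_betw_imp_surj_on[OF z] u by simp
    then obtain t where "t \<le> l" "u = z t"
      by auto
    then show ?thesis
      using le[of 0 t] le[of t l] by simp
  qed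
  have ends: "z 0 \<in> pverts G" "z l \<in> pverts G"
    using z by (auto simp: bij_betw_def)
  have "finite (pverts G)"
    using z bij_betw_finite by blast
  then have "label_span G f = nat \<bar>int (f (z l)) - int (f (z 0))\<bar>"
    unfolding label_span_def
  proof (intro Max_eqI finite_label_differences)
    fix d assume "d \<in> {nat \<bar>int (f u) - int (f v)\<bar> | u v. u \<in> pverts G \<and> v \<in> pverts G}"
    then obtain u v where "u \<in> pverts G" "v \<in> pverts G" "d = nat \<bar>int (f u) - int (f v)\<bar>"
      by auto
    with range[of u] range[of v] show "d \<le> nat \<bar>int (f (z l)) - int (f (z 0))\<bar>"
      by auto
  qed (use ends in auto)
  then show ?thesis
    using le[of 0 l] by simp
qed

context connected_graph
begin

lemma radio_labeling_inj:
  assumes "radio_labeling G f"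
  shows "inj_on f (pverts G)"
proof (rule inj_onI, rule ccontr)
  fix u v assume uv: "u \<in> pverts G" "v \<in> pverts G" "f u = f v" "u \<noteq> v"
  with assms have "int (diam G) + 1 - int (gdist G u v) \<le> \<bar>int (f u) - int (f v)\<bar>"
    unfolding radio_labeling_def by blast
  with gdist_le_diam[of u v] uv show False
    by simp
qed

text \<open>
  Any injective labeling, scaled by \<^term>\<open>diam G + 1\<close>, is a radio labeling. This makes the
  infimum in the definition of the radio number an attained minimum, instead of the default
  value \<open>0\<close> of an infimum over the empty set.
\<close>

lemma radio_labeling_exists: "\<exists>f. radio_labeling G f"
proof -
  obtain e :: "'a \<Rightarrow> nat" where e: "inj_on e (pverts G)"
    using finite_imp_inj_to_nat_seg pair_finite_verts by metis
  have "radio_labeling G (\<lambda>u. e u * (diam G + 1))"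
    unfolding radio_labeling_def
  proof (intro ballI impI)
    fix u v assume "u \<in> pverts G" "v \<in> pverts G" "u \<noteq> v"
    with e have "e u \<noteq> e v"
      by (simp add: inj_on_eq_iff)
    then have "1 \<le> \<bar>int (e u) - int (e v)\<bar>"
      by simp
    then have "1 * (int (diam G) + 1) \<le> \<bar>int (e u) - int (e v)\<bar> * (int (diam G) + 1)"
      by (rule mult_right_mono) simp
    also have "\<dots> = \<bar>(int (e u) - int (e v)) * (int (diam G) + 1)\<bar>"
      by (simp add: abs_mult)
    finally show "int (diam G) + 1 - int (gdist G u v)
        \<le> \<bar>int (e u * (diam G + 1)) - int (e v * (diam G + 1))\<bar>"
      by (simp add: algebra_simps)
  qed
  then show ?thesis
    by blast
qed

lemma radio_number_attained:
  obtains f where "radio_labeling G f" "label_span G f = radio_number G"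
proof -
  have "{label_span G f | f. radio_labeling G f} \<noteq> {}"
    using radio_labeling_exists by auto
  then have "radio_number G \<in> {label_span G f | f. radio_labeling G f}"
    unfolding radio_number_def by (metis (no_types, lifting) all_not_in_conv wellorder_InfI)
  then show thesis
    using that by auto
qed

lemma radio_number_le_span: "radio_labeling G f \<Longrightarrow> radio_number G \<le> label_span G f"
  unfolding radio_number_def by (rule wellorder_Inf_le1) auto

text \<open>
  Along an increasing enumeration the absolute values in the radio condition disappear; this is the
  form in which labelings are analysed and constructed.
\<close>

lemma radio_labeling_increasing_iff:
  fixes z :: "nat \<Rightarrow> 'a" and f :: "'a \<Rightarrow> nat"
  assumes z: "bij_betw z {0..l} (pverts G)"
    and mono: "strict_mono_on {0..l} (\<lambda>t. f (z t))"
  shows "radio_labeling G f \<longleftrightarrow>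
    (\<forall>a b. a < b \<and> b \<le> l \<longrightarrow>
       int (f (z b)) - int (f (z a)) \<ge> int (diam G) + 1 - int (gdist G (z a) (z b)))"
    (is "_ \<longleftrightarrow> ?R")
proof
  assume f: "radio_labeling G f"
  show ?R
  proof (intro allI impI)
    fix a b assume ab: "a < b \<and> b \<le> l"
    then have "z a \<in> pverts G" "z b \<in> pverts G"
      using bij_betwE[OF z] by auto
    moreover have "z a \<noteq> z b"
      using strict_mono_onD[OF mono, of a b] ab by auto
    ultimately have "int (diam G) + 1 - int (gdist G (z a) (z b)) \<le> \<bar>int (f (z a)) - int (f (z b))\<bar>"
      using f by (simp add: radio_labeling_def)
    then show "int (f (z b)) - int (f (z a)) \<ge> int (diam G) + 1 - int (gdist G (z a) (z b))"
      using strict_mono_onD[OF mono, of a b] ab by simp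
  qed
next
  assume R: ?R
  show "radio_labeling G f"
    unfolding radio_labeling_def
  proof (intro ballI impI)
    fix u v assume uv: "u \<in> pverts G" "v \<in> pverts G" "u \<noteq> v"
    have "u \<in> z ` {0..l}" "v \<in> z ` {0..l}"
      using bij_betw_imp_surj_on[OF z] uv by simp_all
    then obtain a b where ab: "a \<le> l" "b \<le> l" "u = z a" "v = z b"
      by auto
    then consider "a < b" | "b < a"
      using uv by fastforce
    then show "int (diam G) + 1 - int (gdist G u v) \<le> \<bar>int (f u) - int (f v)\<bar>"
    proof cases
      case 1
      with R ab have "int (diam G) + 1 - int (gdist G u v) \<le> int (f v) - int (f u)"
        by simp
      then show ?thesis by simp
    next
      case 2
      with R ab have "int (diam G) + 1 - int (gdist G v u) \<le> int (f u) - int (f v)"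
        by simp
      then show ?thesis
        using gdist_commute uv by simp
    qed
  qed
qed

end

section \<open>Weight centers and levels of trees\<close>

locale tree_graph = pair_graph G + connected_graph G for G +
  assumes cycle_length_less: "cycle p \<Longrightarrow> length p < 3"
begin

text \<open>
  A walk from \<open>a\<close> to \<open>v\<close> through \<open>b \<noteq> a\<close> ends with a walk from \<open>b\<close> to \<open>v\<close> that is strictly
  shorter, hence is longer than the distance from \<open>b\<close> to \<open>v\<close>.
\<close>

lemma short_walk_avoids:
  assumes p: "awalk a p v" "length p \<le> gdist G b v" and "a \<noteq> b"
  shows "b \<notin> set (awalk_verts a p)"
proof
  assume "b \<in> set (awalk_verts a p)"
  then obtain q r where qr: "p = q @ r" "awalk a q b" "awalk b r v"
    using awalk_decomp p by blast
  moreover have "q \<noteq> []"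
    using qr(2) \<open>a \<noteq> b\<close> by (auto simp: awalk_Nil_iff)
  ultimately show False
    using gdist_le_length[of b r v] p(2) by (cases q) auto
qed

text \<open>
  A walk between two neighbours of \<open>b\<close> that avoided \<open>b\<close> would shrink to a path and close up through
  \<open>b\<close> to a cycle. As \<open>a \<noteq> c\<close>, this path has at least one arc, so the cycle has at least three and is
  not one of the closed walks along a single edge that the notion of a tree tolerates.
\<close>

lemma no_detour:
  assumes arcs: "(b, a) \<in> parcs G" "(b, c) \<in> parcs G" and "a \<noteq> c"
    and r: "awalk a r c"
  shows "b \<in> set (awalk_verts a r)"
proof (rule ccontr)
  assume avoid: "b \<notin> set (awalk_verts a r)"
  define s where "s = awalk_to_apath r"
  have s: "apath a s c"
    using apath_awalk_to_apath[OF r] by (simp add: s_def)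
  have s_ne: "s \<noteq> []" and r_ne: "r \<noteq> []"
    using s r \<open>a \<noteq> c\<close> by (metis apath_Nil_iff, metis awalk_Nil_iff)
  have "set s \<subseteq> set r"
    using awalk_to_apath_subset[OF r] by (simp add: s_def)
  then have "set (awalk_verts a s) \<subseteq> set (awalk_verts a r)"
    using set_awalk_verts_not_Nil[of a s c] set_awalk_verts_not_Nil[OF r r_ne] s s_ne
    unfolding apath_def by auto
  with avoid have b: "b \<notin> set (awalk_verts a s)"
    by auto
  let ?C = "(b, a) # s @ [(c, b)]"
  have walk: "awalk b ?C b"
    using s arcs by (auto simp: apath_def awalk_simps arcs_symmetric wellformed')
  have "awalk_verts b ?C = b # awalk_verts a s @ [b]"
    using s by (auto simp: apath_def awalk_verts_append2 awalk_verts_conv s_ne dest: awalk_ends)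
  then have "cycle ?C"
    using walk s b by (auto simp: cycle_def apath_def)
  moreover have "3 \<le> length ?C"
    using s_ne by (cases s) auto
  ultimately show False
    using cycle_length_less by fastforce
qed

text \<open>
  Otherwise shortest walks from \<open>a\<close> to \<open>v\<close> and from \<open>v\<close> to \<open>c\<close> both avoid \<open>b\<close>, and their
  concatenation contradicts \<open>no_detour\<close>.
\<close>

lemma at_most_one_neighbour_not_farther:
  assumes arcs: "(b, a) \<in> parcs G" "(b, c) \<in> parcs G" and "a \<noteq> c" and v: "v \<in> pverts G"
    and closer: "gdist G a v \<le> gdist G b v"
  shows "gdist G b v < gdist G c v"
proof (rule ccontr)
  assume "\<not> gdist G b v < gdist G c v"
  then have closer': "gdist G c v \<le> gdist G b v"
    by simp
  have ne: "a \<noteq> b" "c \<noteq> b"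
    using arcs no_loops' by blast+
  obtain p where p: "awalk a p v" "length p = gdist G a v"
    using geodesic v arcs wellformed' by metis
  obtain q where q: "awalk c q v" "length q = gdist G c v"
    using geodesic v arcs wellformed' by metis
  have "b \<notin> set (awalk_verts a p)" "b \<notin> set (awalk_verts c q)"
    using short_walk_avoids p q closer closer' ne by auto
  moreover have "awalk_verts v (rev_path q) = rev (awalk_verts c q)"
    using awalk_verts_rev_path[OF q(1)] .
  moreover have walk: "awalk a (p @ rev_path q) c"
    using p(1) q(1) by auto
  ultimately have "b \<notin> set (awalk_verts a (p @ rev_path q))"
    using set_awalk_verts_append p(1) q(1) by (metis Un_iff awalk_rev_path set_rev)
  with no_detour[OF arcs \<open>a \<noteq> c\<close> walk] show False
    by simp
qed

text \<open>
  Passing from \<open>b\<close> to a neighbour changes the distance to a vertex \<open>v\<close> by at most one, and for one of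
  the neighbours \<open>a\<close>, \<open>c\<close> it grows by one. So each \<open>v\<close> contributes to the right-hand side at least
  what it contributes to the left-hand side, and \<open>v = b\<close> contributes more.
\<close>

lemma weight_strictly_convex:
  assumes arcs: "(b, a) \<in> parcs G" "(b, c) \<in> parcs G" and "a \<noteq> c"
  shows "2 * weight G b < weight G a + weight G c"
proof -
  have verts: "a \<in> pverts G" "b \<in> pverts G" "c \<in> pverts G"
    using arcs wellformed' by auto
  have "(\<Sum>v\<in>pverts G. 2 * gdist G b v) < (\<Sum>v\<in>pverts G. gdist G a v + gdist G c v)"
  proof (rule sum_strict_mono_ex1[OF pair_finite_verts])
    show "\<forall>v\<in>pverts G. 2 * gdist G b v \<le> gdist G a v + gdist G c v"
    proof
      fix v assume v: "v \<in> pverts G"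
      show "2 * gdist G b v \<le> gdist G a v + gdist G c v"
        using gdist_arc_le[OF arcs(1) v] gdist_arc_le[OF arcs(2) v]
          at_most_one_neighbour_not_farther[OF arcs \<open>a \<noteq> c\<close> v] by linarith
    qed
    have "a \<noteq> b"
      using arcs no_loops' by blast
    then show "\<exists>v\<in>pverts G. 2 * gdist G b v < gdist G a v + gdist G c v"
      using verts gdist_eq_0_iff[of a b] by (intro bexI[of _ b]) auto
  qed
  then show ?thesis
    by (simp add: weight_def sum.distrib flip: sum_distrib_left)
qed

lemma weight_center_minimal: "w \<in> weight_centers G \<Longrightarrow> v \<in> pverts G \<Longrightarrow> weight G w \<le> weight G v"
  by (simp add: weight_centers_def)

text \<open>
  Walking from a weight center \<open>w\<close> along a path, the weight cannot decrease in the first step; by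
  strict convexity it increases in every later one. The induction exhibits the predecessor \<open>z'\<close> of
  \<open>z\<close> on such a path.
\<close>

lemma weight_increases_away_from_center:
  assumes w: "w \<in> weight_centers G" and z: "z \<in> pverts G"
    and dist: "gdist G z w = Suc r"
  shows "\<exists>z'. (z, z') \<in> parcs G \<and> gdist G z' w = r \<and> weight G z' \<le> weight G z
           \<and> (r > 0 \<longrightarrow> weight G z' < weight G z)"
  using z dist
proof (induction r arbitrary: z)
  case 0
  have wV: "w \<in> pverts G"
    using w by (simp add: weight_centers_def)
  have "z \<noteq> w"
    using 0 by auto
  then obtain z' where z': "(z, z') \<in> parcs G" "gdist G z w = Suc (gdist G z' w)"
    using gdist_step[OF 0(1) wV] by blast
  moreover from this have "z' \<in> pverts G"
    using wellformed' by blast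
  ultimately have "z' = w"
    using 0 gdist_eq_0_iff[of z' w] wV by simp
  then show ?case
    using z' 0 w by (auto simp: weight_centers_def)
next
  case (Suc r)
  have wV: "w \<in> pverts G"
    using w by (simp add: weight_centers_def)
  have "z \<noteq> w"
    using Suc.prems by auto
  then obtain z' where arc: "(z, z') \<in> parcs G" "gdist G z w = Suc (gdist G z' w)"
    using gdist_step[OF Suc.prems(1) wV] by blast
  then have z': "(z, z') \<in> parcs G" "z' \<in> pverts G" "gdist G z' w = Suc r"
    using Suc.prems(2) in_arcsD2 by auto
  obtain z'' where z'': "(z', z'') \<in> parcs G" "gdist G z'' w = r"
      "weight G z'' \<le> weight G z'"
    using Suc.IH[OF z'(2,3)] by blast
  have "z'' \<noteq> z"
    using z'' Suc.prems by auto
  then have "2 * weight G z' < weight G z'' + weight G z"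
    using weight_strictly_convex z' z'' arcs_symmetric by blast
  then have "weight G z' < weight G z"
    using z''(3) by linarith
  then show ?case
    using z'(1,3) by (meson less_imp_le)
qed

lemma gdist_weight_centers_le_1:
  assumes w: "w \<in> weight_centers G" "w' \<in> weight_centers G"
  shows "gdist G w w' \<le> 1"
proof (rule ccontr)
  assume "\<not> gdist G w w' \<le> 1"
  then obtain r where r: "gdist G w w' = Suc r" "r > 0"
    by (cases "gdist G w w'") auto
  have "w \<in> pverts G"
    using w by (simp add: weight_centers_def)
  then obtain z' where "(w, z') \<in> parcs G" "weight G z' < weight G w"
    using weight_increases_away_from_center[OF w(2) _ r(1)] r(2) by blast
  moreover from this have "z' \<in> pverts G"
    using wellformed' by blast
  ultimately show False
    using w(1) by (meson weight_center_minimal not_le)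
qed

lemma finite_weight_centers: "finite (weight_centers G)"
  using pair_finite_verts by (auto simp: weight_centers_def)

lemma weight_centers_nonempty: "weight_centers G \<noteq> {}"
proof -
  obtain u where "u \<in> pverts G" "weight G u = Min (weight G ` pverts G)"
    using Min_in[of "weight G ` pverts G"] pair_finite_verts verts_nonempty by fastforce
  then have "u \<in> weight_centers G"
    using pair_finite_verts by (auto simp: weight_centers_def)
  then show ?thesis
    by auto
qed

lemma level_attained:
  obtains w where "w \<in> weight_centers G" "level G u = gdist G u w"
proof -
  have "{gdist G u w | w. w \<in> weight_centers G} = gdist G u ` weight_centers G"
    by auto
  then have "level G u \<in> gdist G u ` weight_centers G"
    unfolding level_def using finite_weight_centers weight_centers_nonempty by (simp add: Min_in)
  then show thesis
    using that by auto
qed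

text \<open>
  The route from \<open>u\<close> to \<open>v\<close> via nearest weight centers \<open>w\<close> and \<open>w'\<close> has length
  \<open>level u + d(w, w') + level v\<close>. The middle part is \<open>0\<close> if there is only one center, and at most
  \<open>1\<close> otherwise.
\<close>

lemma gdist_le_levels:
  assumes "u \<in> pverts G" "v \<in> pverts G"
  shows "gdist G u v + center_eps G \<le> level G u + level G v + 1"
proof -
  obtain w where w: "w \<in> weight_centers G" "level G u = gdist G u w"
    using level_attained .
  obtain w' where w': "w' \<in> weight_centers G" "level G v = gdist G v w'"
    using level_attained .
  have wV: "w \<in> pverts G" "w' \<in> pverts G"
    using w w' by (auto simp: weight_centers_def)
  have "gdist G u v \<le> gdist G u w + gdist G w w' + gdist G w' v"
    using gdist_triangle[of u w v] gdist_triangle[of w w' v] assms wV by linarith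
  moreover have "gdist G w' v = gdist G v w'"
    using gdist_commute assms wV by simp
  moreover have "gdist G w w' + center_eps G \<le> 1"
  proof (cases "card (weight_centers G) = 1")
    case True
    then have "w = w'"
      using w w' by (metis card_1_singletonE singletonD)
    then show ?thesis
      using wV by (simp add: center_eps_def)
  next
    case False
    then show ?thesis
      using gdist_weight_centers_le_1 w w' by (simp add: center_eps_def)
  qed
  ultimately show ?thesis
    using w w' by linarith
qed

end

lemma tree_graphI:
  assumes "undirected_tree T"
  shows "tree_graph T"
proof -
  interpret pair_graph T
    using assms by (simp add: undirected_tree_def)
  have "strongly_connected (with_proj T)"
    using assms symmetric_connected_imp_strongly_connected[OF sym_arcs]
    by (simp add: undirected_tree_def)
  then show ?thesis
    using assms
    by unfold_locales
      (auto simp: strongly_connected_def undirected_tree_def reachable_awalk not_le)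
qed

section \<open>Radio labelings of the product with a tree\<close>

lemma sum_telescoped_pairs:
  fixes c :: int and a :: "nat \<Rightarrow> int"
  shows "(\<Sum>t<l. c - a t - a (Suc t)) = int l * c - 2 * (\<Sum>t\<le>l. a t) + a 0 + a l"
  by (induction l) (auto simp: algebra_simps)

locale tree_product = graph_product G T + H: tree_graph T
  for G :: "'a pair_pre_digraph" and T :: "'b pair_pre_digraph"
begin

text \<open>
  The lower bound for the label difference of two distinct vertices of the product that depends
  on their tree components only.
\<close>

definition tight_gap :: "'b \<Rightarrow> 'b \<Rightarrow> int" where
  "tight_gap y y' = int (diam T) + int (center_eps T) - int (level T y) - int (level T y')"

text \<open>
  The sum of the tight gaps along an enumeration of the product that starts and ends with tree
  component at level \<open>0\<close>.
\<close>

definition span_bound :: int where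
  "span_bound = (int (card (pverts G)) * int (card (pverts T)) - 1) * (int (diam T) + int (center_eps T))
     - 2 * int (card (pverts G)) * int (total_level T)"

lemma radio_gap_ge_tight_gap:
  assumes "x \<in> pverts G" "x' \<in> pverts G" "y \<in> pverts T" "y' \<in> pverts T"
  shows "tight_gap y y' + (int (diam G) - int (gdist G x x'))
    \<le> int (diam (G \<box> T)) + 1 - int (gdist (G \<box> T) (x, y) (x', y'))"
  using H.gdist_le_levels[of y y'] assms by (simp add: tight_gap_def gdist_product diam_product)

text \<open>
  An enumeration of the product meets every vertex of the tree once for each vertex of \<open>G\<close>.
\<close>

lemma sum_levels:
  fixes x :: "nat \<Rightarrow> 'a" and y :: "nat \<Rightarrow> 'b"
  assumes "bij_betw (\<lambda>t. (x t, y t)) {0..l} (pverts (G \<box> T))"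
  shows "(\<Sum>t\<le>l. int (level T (y t))) = int (card (pverts G)) * int (total_level T)"
proof -
  have "(\<Sum>t\<in>{0..l}. int (level T (snd (x t, y t)))) = (\<Sum>v\<in>pverts (G \<box> T). int (level T (snd v)))"
    using sum.reindex_bij_betw[OF assms, of "\<lambda>v. int (level T (snd v))"] by simp
  also have "\<dots> = (\<Sum>x\<in>pverts G. \<Sum>y\<in>pverts T. int (level T y))"
    by (simp add: sum.cartesian_product case_prod_beta del: sum_constant)
  finally show ?thesis
    by (simp add: total_level_def atLeast0AtMost)
qed

text \<open>
  The span is the sum of the consecutive label differences; splitting off the tight gaps, whose sum
  telescopes, leaves the excesses.
\<close>

lemma span_eq_bound_plus_excess:
  fixes x :: "nat \<Rightarrow> 'a" and y :: "nat \<Rightarrow> 'b"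
  assumes z: "bij_betw (\<lambda>t. (x t, y t)) {0..l} (pverts (G \<box> T))"
    and mono: "strict_mono_on {0..l} (\<lambda>t. f (x t, y t))"
  shows "int (label_span (G \<box> T) f) = span_bound + int (level T (y 0)) + int (level T (y l))
    + (\<Sum>t<l. int (f (x (Suc t), y (Suc t))) - int (f (x t, y t)) - tight_gap (y t) (y (Suc t)))"
proof -
  have "card (pverts (G \<box> T)) = Suc l"
    using bij_betw_same_card[OF z] by simp
  then have l: "int l = int (card (pverts G)) * int (card (pverts T)) - 1"
    by (simp add: card_cartesian_product flip: of_nat_mult)
  have "int (label_span (G \<box> T) f) = int (f (x l, y l)) - int (f (x 0, y 0))"
    using label_span_ordered[OF z mono] by simp
  also have "\<dots> = (\<Sum>t<l. int (f (x (Suc t), y (Suc t))) - int (f (x t, y t)))"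
    by (rule sum_lessThan_telescope[symmetric])
  also have "\<dots> = (\<Sum>t<l. tight_gap (y t) (y (Suc t)))
      + (\<Sum>t<l. int (f (x (Suc t), y (Suc t))) - int (f (x t, y t)) - tight_gap (y t) (y (Suc t)))"
    by (simp flip: sum.distrib)
  also have "(\<Sum>t<l. tight_gap (y t) (y (Suc t)))
      = span_bound + int (level T (y 0)) + int (level T (y l))"
    using sum_telescoped_pairs[of "int (diam T) + int (center_eps T)" "\<lambda>t. int (level T (y t))" l]
    by (simp add: tight_gap_def span_bound_def sum_levels[OF z] l algebra_simps)
  finally show ?thesis .
qed

lemma labeling_ordering:
  assumes f: "radio_labeling (G \<box> T) f" and card: "card (pverts (G \<box> T)) = Suc l"
  obtains x :: "nat \<Rightarrow> 'a" and y :: "nat \<Rightarrow> 'b" where "bij_betw (\<lambda>t. (x t, y t)) {0..l} (pverts (G \<box> T))"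
    "strict_mono_on {0..l} (\<lambda>t. f (x t, y t))"
proof -
  obtain z where z: "bij_betw z {0..l} (pverts (G \<box> T))"
      "strict_mono_on {0..l} (\<lambda>t. f (z t))"
    using finite_injective_ordering[OF P.pair_finite_verts P.radio_labeling_inj[OF f] card] .
  show thesis
    using z by (intro that[of "fst \<circ> z" "snd \<circ> z"]) auto
qed

lemma ordering_in_verts:
  fixes x :: "nat \<Rightarrow> 'a" and y :: "nat \<Rightarrow> 'b"
  assumes "bij_betw (\<lambda>t. (x t, y t)) {0..l} (pverts (G \<box> T))" "t \<le> l"
  shows "x t \<in> pverts G" "y t \<in> pverts T"
  using bij_betwE[OF assms(1)] assms(2) by auto

lemma excess_ge:
  fixes x :: "nat \<Rightarrow> 'a" and y :: "nat \<Rightarrow> 'b"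
  assumes f: "radio_labeling (G \<box> T) f"
    and z: "bij_betw (\<lambda>t. (x t, y t)) {0..l} (pverts (G \<box> T))"
    and mono: "strict_mono_on {0..l} (\<lambda>t. f (x t, y t))"
    and t: "t < l"
  shows "int (diam G) - int (gdist G (x t) (x (Suc t)))
    \<le> int (f (x (Suc t), y (Suc t))) - int (f (x t, y t)) - tight_gap (y t) (y (Suc t))"
proof -
  have "int (diam (G \<box> T)) + 1 - int (gdist (G \<box> T) (x t, y t) (x (Suc t), y (Suc t)))
      \<le> int (f (x (Suc t), y (Suc t))) - int (f (x t, y t))"
    using P.radio_labeling_increasing_iff[OF z mono] f t by simp
  moreover have "tight_gap (y t) (y (Suc t)) + (int (diam G) - int (gdist G (x t) (x (Suc t))))
      \<le> int (diam (G \<box> T)) + 1 - int (gdist (G \<box> T) (x t, y t) (x (Suc t), y (Suc t)))"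
    using t by (intro radio_gap_ge_tight_gap ordering_in_verts[OF z]) auto
  ultimately show ?thesis
    by linarith
qed

lemma excess_nonneg:
  fixes x :: "nat \<Rightarrow> 'a" and y :: "nat \<Rightarrow> 'b"
  assumes f: "radio_labeling (G \<box> T) f"
    and z: "bij_betw (\<lambda>t. (x t, y t)) {0..l} (pverts (G \<box> T))"
    and mono: "strict_mono_on {0..l} (\<lambda>t. f (x t, y t))"
    and t: "t < l"
  shows "0 \<le> int (f (x (Suc t), y (Suc t))) - int (f (x t, y t)) - tight_gap (y t) (y (Suc t))"
proof -
  have "gdist G (x t) (x (Suc t)) \<le> diam G"
    using t by (intro G.gdist_le_diam ordering_in_verts[OF z]) auto
  with excess_ge[OF f z mono t] show ?thesis
    by simp
qed

lemma card_verts_pos: "card (pverts (G \<box> T)) > 0"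
  using P.verts_nonempty P.pair_finite_verts by (simp only: card_gt_0_iff) simp

lemma span_bound_le_radio_number: "span_bound \<le> int (radio_number (G \<box> T))"
proof -
  obtain f where f: "radio_labeling (G \<box> T) f" "label_span (G \<box> T) f = radio_number (G \<box> T)"
    using P.radio_number_attained .
  obtain l where l: "card (pverts (G \<box> T)) = Suc l"
    using card_verts_pos gr0_implies_Suc by blast
  obtain x y where z: "bij_betw (\<lambda>t. (x t, y t)) {0..l} (pverts (G \<box> T))"
      "strict_mono_on {0..l} (\<lambda>t. f (x t, y t))"
    using labeling_ordering[OF f(1) l] .
  have "0 \<le> (\<Sum>t<l. int (f (x (Suc t), y (Suc t))) - int (f (x t, y t)) - tight_gap (y t) (y (Suc t)))"
    using excess_nonneg[OF f(1) z] by (intro sum_nonneg) auto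
  then show ?thesis
    using span_eq_bound_plus_excess[OF z] f(2) by simp
qed

text \<open>
  For an optimal labeling the levels of the ends and the excesses are nonnegative and add up to
  \<open>0\<close>, so all of them vanish.
\<close>

lemma tight_ordering_of_optimal_labeling:
  assumes rn: "int (radio_number (G \<box> T)) = span_bound" and l: "card (pverts (G \<box> T)) = Suc l"
  obtains x :: "nat \<Rightarrow> 'a" and y :: "nat \<Rightarrow> 'b" where "bij_betw (\<lambda>t. (x t, y t)) {0..l} (pverts (G \<box> T))"
    "\<And>t. t < l \<Longrightarrow> gdist G (x t) (x (Suc t)) = diam G"
    "level T (y 0) = 0" "level T (y l) = 0"
    "\<And>a b. a < b \<Longrightarrow> b \<le> l \<Longrightarrow>
       int (diam T) + int (diam G) + 1 - (\<Sum>t = a..<b. tight_gap (y t) (y (Suc t)))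
         \<le> int (gdist T (y a) (y b)) + int (gdist G (x a) (x b))"
proof -
  obtain f where f: "radio_labeling (G \<box> T) f" "label_span (G \<box> T) f = radio_number (G \<box> T)"
    using P.radio_number_attained .
  obtain x y where z: "bij_betw (\<lambda>t. (x t, y t)) {0..l} (pverts (G \<box> T))"
      and mono: "strict_mono_on {0..l} (\<lambda>t. f (x t, y t))"
    using labeling_ordering[OF f(1) l] .
  define e where "e t = int (f (x (Suc t), y (Suc t))) - int (f (x t, y t)) - tight_gap (y t) (y (Suc t))"
    for t
  have e_nonneg: "0 \<le> e t" if "t < l" for t
    using excess_nonneg[OF f(1) z mono that] by (simp add: e_def)
  then have sum_nonneg: "0 \<le> (\<Sum>t<l. e t)"
    by (intro sum_nonneg) auto
  have total: "int (level T (y 0)) + int (level T (y l)) + (\<Sum>t<l. e t) = 0"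
    using span_eq_bound_plus_excess[OF z mono] rn f(2) by (simp add: e_def)
  then have "(\<Sum>t<l. e t) = 0"
    using sum_nonneg by linarith
  then have e_0: "e t = 0" if "t < l" for t
    using that e_nonneg sum_nonneg_eq_0_iff[of "{..<l}" e] by simp
  show thesis
  proof (rule that[OF z])
    show "level T (y 0) = 0" "level T (y l) = 0"
      using total sum_nonneg by linarith+
    show "gdist G (x t) (x (Suc t)) = diam G" if t: "t < l" for t
    proof (rule antisym)
      show "gdist G (x t) (x (Suc t)) \<le> diam G"
        using t by (intro G.gdist_le_diam ordering_in_verts[OF z]) auto
      show "diam G \<le> gdist G (x t) (x (Suc t))"
        using excess_ge[OF f(1) z mono t] e_0[OF t] by (simp add: e_def)
    qed
    show "int (diam T) + int (diam G) + 1 - (\<Sum>t = a..<b. tight_gap (y t) (y (Suc t)))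
        \<le> int (gdist T (y a) (y b)) + int (gdist G (x a) (x b))" if ab: "a < b" "b \<le> l" for a b
    proof -
      have "(\<Sum>t = a..<b. tight_gap (y t) (y (Suc t)))
          = (\<Sum>t = a..<b. int (f (x (Suc t), y (Suc t))) - int (f (x t, y t)))"
        using e_0 ab by (intro sum.cong) (auto simp: e_def)
      also have "\<dots> = int (f (x b, y b)) - int (f (x a, y a))"
        using sum_Suc_diff'[of a b "\<lambda>t. int (f (x t, y t))"] ab by simp
      moreover have "int (diam (G \<box> T)) + 1 - int (gdist (G \<box> T) (x a, y a) (x b, y b))
          \<le> int (f (x b, y b)) - int (f (x a, y a))"
        using P.radio_labeling_increasing_iff[OF z mono] f(1) ab by simp
      ultimately show ?thesis
        using ordering_in_verts[OF z, of a] ordering_in_verts[OF z, of b] ab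
        by (simp add: gdist_product diam_product)
    qed
  qed
qed

text \<open>
  Label the \<open>t\<close>-th vertex with the sum of the tight gaps before it. The assumption \<open>spread\<close> for
  consecutive vertices, with the distances bounded by the diameters, makes these gaps positive, so
  the labels increase and are natural numbers; for arbitrary pairs it is the radio condition. All
  excesses are \<open>0\<close> by construction.
\<close>

lemma radio_number_eq_of_tight_ordering:
  fixes x :: "nat \<Rightarrow> 'a" and y :: "nat \<Rightarrow> 'b"
  assumes z: "bij_betw (\<lambda>t. (x t, y t)) {0..l} (pverts (G \<box> T))"
    and ends: "level T (y 0) = 0" "level T (y l) = 0"
    and spread: "\<And>a b. a < b \<Longrightarrow> b \<le> l \<Longrightarrow>
       int (diam T) + int (diam G) + 1 - (\<Sum>t = a..<b. tight_gap (y t) (y (Suc t)))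
         \<le> int (gdist T (y a) (y b)) + int (gdist G (x a) (x b))"
  shows "int (radio_number (G \<box> T)) = span_bound"
proof -
  have verts: "x t \<in> pverts G" "y t \<in> pverts T" if "t \<le> l" for t
    using ordering_in_verts[OF z that] .
  have gap_pos: "0 < tight_gap (y t) (y (Suc t))" if "t < l" for t
    using spread[of t "Suc t"] that verts[of t] verts[of "Suc t"]
      G.gdist_le_diam[of "x t" "x (Suc t)"] H.gdist_le_diam[of "y t" "y (Suc t)"] by simp
  define F where "F t = (\<Sum>s = 0..<t. tight_gap (y s) (y (Suc s)))" for t
  have F_diff: "F b - F a = (\<Sum>s = a..<b. tight_gap (y s) (y (Suc s)))" if "a \<le> b" for a b
    unfolding F_def using sum.atLeastLessThan_concat[of 0 a b "\<lambda>s. tight_gap (y s) (y (Suc s))"] that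
    by simp
  have F_mono: "F a < F b" if "a < b" "b \<le> l" for a b
  proof -
    have "0 < (\<Sum>s = a..<b. tight_gap (y s) (y (Suc s)))"
      using that gap_pos by (intro sum_pos) auto
    then show ?thesis
      using F_diff[of a b] that by simp
  qed
  have F_nonneg: "0 \<le> F t" if "t \<le> l" for t
    unfolding F_def using that gap_pos by (intro sum_nonneg) (simp add: less_imp_le)
  define f where "f v = nat (F (the_inv_into {0..l} (\<lambda>t. (x t, y t)) v))" for v
  have f_z: "int (f (x t, y t)) = F t" if "t \<le> l" for t
  proof -
    have "the_inv_into {0..l} (\<lambda>t. (x t, y t)) (x t, y t) = t"
      using the_inv_into_f_f[OF bij_betw_imp_inj_on[OF z], of t] that by simp
    then show ?thesis
      using F_nonneg[OF that] by (simp add: f_def)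
  qed
  have mono: "strict_mono_on {0..l} (\<lambda>t. f (x t, y t))"
  proof (rule strict_mono_onI)
    fix a b assume "a \<in> {0..l}" "b \<in> {0..l}" "a < b"
    then show "f (x a, y a) < f (x b, y b)"
      using F_mono[of a b] f_z[of a] f_z[of b] by simp
  qed
  have "radio_labeling (G \<box> T) f"
  proof (subst P.radio_labeling_increasing_iff[OF z mono], intro allI impI)
    fix a b assume ab: "a < b \<and> b \<le> l"
    then have "int (f (x b, y b)) - int (f (x a, y a)) = (\<Sum>t = a..<b. tight_gap (y t) (y (Suc t)))"
      using f_z F_diff[of a b] by simp
    then show "int (diam (G \<box> T)) + 1 - int (gdist (G \<box> T) (x a, y a) (x b, y b))
        \<le> int (f (x b, y b)) - int (f (x a, y a))"
      using spread[of a b] ab verts[of a] verts[of b] by (simp add: gdist_product diam_product)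
  qed
  then have "radio_number (G \<box> T) \<le> label_span (G \<box> T) f"
    by (rule P.radio_number_le_span)
  moreover have "int (label_span (G \<box> T) f) = span_bound"
  proof -
    have "int (f (x (Suc t), y (Suc t))) - int (f (x t, y t)) = tight_gap (y t) (y (Suc t))"
      if "t < l" for t
      using f_z[of t] f_z[of "Suc t"] F_diff[of t "Suc t"] that by simp
    then show ?thesis
      using span_eq_bound_plus_excess[OF z mono] ends by simp
  qed
  ultimately show ?thesis
    using span_bound_le_radio_number by simp
qed

text \<open>
  The subtracted sum of tight gaps is the label difference that a labeling of span
  \<^const>\<open>span_bound\<close> is forced to have, so the last condition is the radio condition for it.
\<close>

theorem radio_number_eq_span_bound_iff:
  assumes l: "card (pverts (G \<box> T)) = Suc l"
  shows "int (radio_number (G \<box> T)) = span_bound \<longleftrightarrow>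
    (\<exists>x y. bij_betw (\<lambda>t. (x t, y t)) {0..l} (pverts (G \<box> T)) \<and>
       (\<forall>t<l. gdist G (x t) (x (Suc t)) = diam G) \<and>
       level T (y 0) = 0 \<and> level T (y l) = 0 \<and>
       (\<forall>a b. a < b \<and> b \<le> l \<longrightarrow>
          int (diam T) + int (diam G) + 1 - (\<Sum>t = a..<b. tight_gap (y t) (y (Suc t)))
            \<le> int (gdist T (y a) (y b)) + int (gdist G (x a) (x b))))"
    (is "_ \<longleftrightarrow> ?ex")
proof
  assume "int (radio_number (G \<box> T)) = span_bound"
  then show ?ex
    by (rule tight_ordering_of_optimal_labeling[OF _ l]) blast
qed (use radio_number_eq_of_tight_ordering in blast)

end

section \<open>Generalized Petersen graphs\<close>

lemma card_petersen: "card (pverts (petersen m k)) = 2 * m"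
proof -
  have "card (U ` {..<m} \<union> V ` {..<m}) = card (U ` {..<m}) + card (V ` {..<m})"
    by (rule card_Un_disjoint) auto
  then show ?thesis
    by (simp add: petersen_def Let_def card_image inj_on_def)
qed

lemma pair_pseudo_graph_petersen:
  assumes "m > 0"
  shows "pair_pseudo_graph (petersen m k)"
proof
  have sub: "parcs (petersen m k) \<subseteq> pverts (petersen m k) \<times> pverts (petersen m k)"
    using assms by (auto simp: petersen_def Let_def)
  then show "fst e \<in> pverts (petersen m k)" "snd e \<in> pverts (petersen m k)"
    if "e \<in> parcs (petersen m k)" for e
    using that by auto
  show fin: "finite (pverts (petersen m k))"
    by (simp add: petersen_def Let_def)
  show "finite (parcs (petersen m k))"
    using sub fin by (meson finite_SigmaI finite_subset)
  show "symmetric (with_proj (petersen m k))"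
    unfolding symmetric_def with_proj_simps by (rule symI) (auto simp: petersen_def Let_def)
qed

text \<open>
  The vertices \<open>U 0, \<dots>, U (m - 1)\<close> form a path, and every \<open>V i\<close> is joined to \<open>U i\<close>.
\<close>

lemma connected_graph_petersen:
  assumes "m > 0"
  shows "connected_graph (petersen m k)"
proof -
  let ?P = "petersen m k"
  interpret pair_pseudo_graph ?P
    using assms by (rule pair_pseudo_graph_petersen)
  have verts: "pverts ?P = U ` {..<m} \<union> V ` {..<m}"
    by (simp add: petersen_def Let_def)
  have rim: "(U i, U (Suc i)) \<in> parcs ?P" if "Suc i < m" for i
    using that by (force simp: petersen_def Let_def)
  have spoke: "(U i, V i) \<in> parcs ?P" if "i < m" for i
    using that by (auto simp: petersen_def Let_def)
  have to_U: "\<exists>p. awalk (U 0) p (U i)" if "i < m" for i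
    using that
  proof (induction i)
    case 0
    then show ?case
      using verts by (intro exI[of _ "[]"]) (auto simp: awalk_Nil_iff)
  next
    case (Suc i)
    then obtain p where "awalk (U 0) p (U i)"
      by auto
    moreover have "awalk (U i) [(U i, U (Suc i))] (U (Suc i))"
      using arc_implies_awalk[OF rim[OF Suc.prems]] by simp
    ultimately show ?case
      using awalk_appendI by blast
  qed
  have from_0: "\<exists>p. awalk (U 0) p v" if v: "v \<in> pverts ?P" for v
  proof -
    consider i where "i < m" "v = U i" | i where "i < m" "v = V i"
      using v verts by auto
    then show ?thesis
    proof cases
      case 1
      then show ?thesis
        using to_U by simp
    next
      case (2 i)
      then obtain p where "awalk (U 0) p (U i)"
        using to_U by auto
      moreover have "awalk (U i) [(U i, V i)] (V i)"
        using arc_implies_awalk[OF spoke[OF 2(1)]] by simp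
      ultimately show ?thesis
        using 2 awalk_appendI by blast
    qed
  qed
  show ?thesis
  proof
    show "pverts ?P \<noteq> {}"
      using assms verts by auto
    fix u v assume "u \<in> pverts ?P" "v \<in> pverts ?P"
    then obtain p q where "awalk (U 0) p u" "awalk (U 0) q v"
      using from_0 by meson
    then have "awalk u (rev_path p @ q) v"
      using awalk_rev_path by (metis awalk_appendI)
    then show "\<exists>p. awalk u p v" ..
  qed
qed

theorem theorem3p2:
  fixes m k n :: nat
    and T :: "'a pair_pre_digraph"
    and d_p d_t \<epsilon> :: int
  assumes "m \<ge> 3" and "k \<ge> 1"
    and "undirected_tree T" and "card (pverts T) = n"
    and "d_p = int (diam (petersen m k))"
    and "d_t = int (diam T)"
    and "\<epsilon> = int (center_eps T)"
  shows "int (radio_number (petersen m k \<box> T))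
           = (2 * int m * int n - 1) * (d_t + \<epsilon>) - 4 * int m * int (total_level T)
     \<longleftrightarrow>
     (\<exists>(x :: nat \<Rightarrow> petersen_vertex) (y :: nat \<Rightarrow> 'a).
        bij_betw (\<lambda>t. (x t, y t)) {0..2 * m * n - 1} (pverts (petersen m k \<box> T)) \<and>
        (\<forall>t. t \<le> 2 * m * n - 2 \<longrightarrow> int (gdist (petersen m k) (x t) (x (t + 1))) = d_p) \<and>
        level T (y 0) + level T (y (2 * m * n - 1)) = 0 \<and>
        (\<forall>a b. a < b \<and> b \<le> 2 * m * n - 1 \<longrightarrow>
           int (gdist T (y a) (y b)) + int (gdist (petersen m k) (x a) (x b))
             \<ge> (\<Sum>t = a..b - 1. int (level T (y t)) + int (level T (y (t + 1))) - d_t - \<epsilon>)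
                + d_t + d_p + 1))"
proof -
  interpret T: tree_graph T
    using assms(3) by (rule tree_graphI)
  interpret G: connected_graph "petersen m k"
    using assms(1) by (intro connected_graph_petersen) simp
  interpret tree_product "petersen m k" T ..
  have "n > 0"
    using assms(4) T.verts_nonempty T.pair_finite_verts by (simp add: card_gt_0_iff flip: assms(4))
  then have order_ge_2: "2 * m * n \<ge> 2"
    using assms(1) by (simp add: Suc_le_eq)
  then have t_bound: "t \<le> 2 * m * n - 2 \<longleftrightarrow> t < 2 * m * n - 1" for t
    by linarith
  have card: "card (pverts (petersen m k \<box> T)) = Suc (2 * m * n - 1)"
    using order_ge_2 by (simp add: card_cartesian_product card_petersen assms(4))
  have bound: "(2 * int m * int n - 1) * (d_t + \<epsilon>) - 4 * int m * int (total_level T) = span_bound"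
    by (simp add: span_bound_def card_petersen assms)
  have gaps: "(\<Sum>t = a..b - 1. int (level T (y t)) + int (level T (y (t + 1))) - d_t - \<epsilon>)
      = - (\<Sum>t = a..<b. tight_gap (y t) (y (Suc t)))" if "a < b" for a b :: nat and y
  proof -
    have "{a..b - 1} = {a..<b}"
      using that by auto
    then show ?thesis
      by (simp add: tight_gap_def assms algebra_simps flip: sum_negf)
  qed
  have spread: "int (diam T) + int (diam (petersen m k)) + 1 - (\<Sum>t = a..<b. tight_gap (y t) (y (Suc t)))
        \<le> int (gdist T (y a) (y b)) + int (gdist (petersen m k) (x a) (x b))
    \<longleftrightarrow> (\<Sum>t = a..b - 1. int (level T (y t)) + int (level T (y (t + 1))) - d_t - \<epsilon>)
        + d_t + d_p + 1 \<le> int (gdist T (y a) (y b)) + int (gdist (petersen m k) (x a) (x b))"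
    if "a < b" for a b x y
    using gaps[OF that, of y] assms(5,6) by linarith
  show ?thesis
    unfolding bound radio_number_eq_span_bound_iff[OF card] t_bound
    using spread assms(5) by (auto cong: conj_cong)
qed

end
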